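(* Let $0<q<1$ and $\nu>-1$. For every $f\in\mathcal{L}_{q,2,\nu}$, $$\|f\|_{q,2,\nu}^2\le k_{q,\nu}\,\|xf\|_{q,2,\nu}\,\|x\mathcal{F}_{q,\nu}f\|_{q,2,\nu},\qquad k_{q,\nu}=\frac{1+\sqrt{q}\,q^{\nu+1}}{1-q^{2(\nu+1)}},$$ where $xf$ and $x\mathcal{F}_{q,\nu}f$ denote the functions $x\mapsto xf(x)$ and $x\mapsto x\mathcal{F}_{q,\nu}f(x)$; the inequality is understood as trivially true if one of the two norms on the right is infinite.
   Context: $\mathbb{R}_q^+=\{q^n: n\in\mathbb{Z}\}$. For $a\in\mathbb{C}$, $(a;q^2)_n=\prod_{k=0}^{n-1}(1-aq^{2k})$ and $(a;q^2)_\infty=\prod_{k\ge 0}(1-aq^{2k})$. Jackson integral: $\int_0^\infty f(t)\,d_qt=(1-q)\sum_{n\in\mathbb{Z}}q^nf(q^n)$. For functions $f:\mathbb{R}_q^+\to\mathbb{R}$, $\|f\|_{q,2,\nu}=\left(\int_0^\infty|f(x)|^2x^{2\nu+1}d_qx\right)^{1/2}\in[0,\infty]$, and $\mathcal{L}_{q,2,\nu}$ is the space of those $f$ for which this is finite. Normalized $q$-Bessel function: $j_\nu(x,q^2)=\sum_{n=0}^\infty(-1)^n\frac{q^{n(n+1)}}{(q^{2\nu+2};q^2)_n(q^2;q^2)_n}x^{2n}$. Put $c_{q,\nu}=\frac{1}{1-q}\frac{(q^{2\nu+2};q^2)_\infty}{(q^2;q^2)_\infty}$. The $q$-Bessel Fourier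 transform is $\mathcal{F}_{q,\nu}f(x)=c_{q,\nu}\int_0^\infty f(t)j_\nu(xt,q^2)t^{2\nu+1}d_qt$, $x\in\mathbb{R}_q^+$. *)

theory Defs
  imports "HOL-Analysis.Analysis"
begin

text \<open>
  The lattice of integer powers of \<open>q\<close> is not a type of its own: functions on it are
  represented by functions on \<open>real\<close>. The Jackson integrals, norms and transform below
  inspect their function arguments only at the points \<open>q powi n\<close>, so other values are irrelevant.
\<close>

definition qpoch :: "'a::real_normed_field \<Rightarrow> 'a \<Rightarrow> nat \<Rightarrow> 'a" where
  "qpoch a p n = (\<Prod>k<n. 1 - a * p ^ k)"

definition qpoch_inf :: "'a::real_normed_field \<Rightarrow> 'a \<Rightarrow> 'a" where
  "qpoch_inf a p = (\<Prod>k. 1 - a * p ^ k)"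

definition jackson_integral :: "real \<Rightarrow> (real \<Rightarrow> real) \<Rightarrow> real" where
  "jackson_integral q f = (1 - q) * (\<Sum>\<^sub>\<infinity>n\<in>(UNIV :: int set). q powi n * f (q powi n))"

text \<open>The version for nonnegative integrands, where divergence yields the value \<open>\<infinity>\<close>.\<close>

definition jackson_nn_integral :: "real \<Rightarrow> (real \<Rightarrow> ennreal) \<Rightarrow> ennreal" where
  "jackson_nn_integral q f =
     ennreal (1 - q) * (\<Sum>\<^sub>\<infinity>n\<in>(UNIV :: int set). ennreal (q powi n) * f (q powi n))"

definition ennreal_sqrt :: "ennreal \<Rightarrow> ennreal" where
  "ennreal_sqrt x = (if x = \<infinity> then \<infinity> else ennreal (sqrt (enn2real x)))"

definition q2norm :: "real \<Rightarrow> real \<Rightarrow> (real \<Rightarrow> real) \<Rightarrow> ennreal" where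
  "q2norm q \<nu> f =
     ennreal_sqrt (jackson_nn_integral q (\<lambda>x. ennreal (\<bar>f x\<bar>\<^sup>2 * x powr (2 * \<nu> + 1))))"

definition L2q :: "real \<Rightarrow> real \<Rightarrow> (real \<Rightarrow> real) set" where
  "L2q q \<nu> = {f. q2norm q \<nu> f < \<infinity>}"

text \<open>The base of the q-shifted factorials is \<open>q\<^sup>2\<close>; the parameter here is \<open>q\<close> itself.\<close>

definition qbessel_j :: "real \<Rightarrow> real \<Rightarrow> real \<Rightarrow> real" where
  "qbessel_j q \<nu> x =
     (\<Sum>n. (-1) ^ n * (q ^ (n * (n + 1))
        / (qpoch (q powr (2 * \<nu> + 2)) (q\<^sup>2) n * qpoch (q\<^sup>2) (q\<^sup>2) n)) * x ^ (2 * n))"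

definition qbessel_const :: "real \<Rightarrow> real \<Rightarrow> real" where
  "qbessel_const q \<nu> =
     1 / (1 - q) * (qpoch_inf (q powr (2 * \<nu> + 2)) (q\<^sup>2) / qpoch_inf (q\<^sup>2) (q\<^sup>2))"

definition qbessel_fourier :: "real \<Rightarrow> real \<Rightarrow> (real \<Rightarrow> real) \<Rightarrow> real \<Rightarrow> real" where
  "qbessel_fourier q \<nu> f x =
     qbessel_const q \<nu> *
     jackson_integral q (\<lambda>t. f t * qbessel_j q \<nu> (x * t) * t powr (2 * \<nu> + 1))"

end

theory Submission
  imports Defs
begin

text \<open>
  Let \<open>a = q\<^sup>\<nu>\<^sup>+\<^sup>1\<close> and substitute \<open>u n = a\<^sup>n f (q\<^sup>n)\<close>: the transform becomes the Hankel matrix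
  \<open>J\<^sub>a (m + n)\<close> with \<open>J\<^sub>a k = a\<^sup>k \<psi> k\<close>, where \<open>\<psi> k\<close> is a multiple of \<open>j\<^sub>\<nu> (q\<^sup>k, q\<^sup>2)\<close>. The numbers \<open>\<psi> k\<close> are the Laurent
  coefficients of \<open>(a\<^sup>2/t; q\<^sup>2)\<^sub>\<infinity> / (t; q\<^sup>2)\<^sub>\<infinity>\<close>, so the matrix has orthonormal rows and is an involution.
  Since \<open>J\<^sub>a (k + 1) - a J\<^sub>a k = q\<^sup>k\<^sup>+\<^sup>1 J\<^sub>a\<^sub>q (k + 1)\<close>, inversion and Bessel's inequality bound the norm of
  \<open>D m = q\<^sup>-\<^sup>m (u m - a u (m - 1))\<close> by that of \<open>q\<^sup>n v n\<close>, where \<open>v\<close> is the transform of \<open>u\<close>. The Cauchy--Schwarz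
  inequality applied to \<open>(1 - a\<^sup>2) \<Sum> (u m)\<^sup>2 = \<Sum> D m \<cdot> q\<^sup>m (u m + a u (m - 1))\<close> gives the
  theorem even with \<open>1 + q a\<close> in place of \<open>1 + \<surd>q a\<close>.
\<close>

section \<open>Finite and infinite q-shifted factorials\<close>

lemma qpoch_Suc: "qpoch a p (Suc n) = qpoch a p n * (1 - a * p ^ n)"
  by (simp add: qpoch_def)

lemma qpoch_add: "qpoch a p (m + n) = qpoch a p m * qpoch (a * p ^ m) p n"
  by (induction n) (simp_all add: qpoch_Suc power_add qpoch_def mult_ac)

text \<open>Euler's Taylor coefficients of \<open>(y; p)_inf\<close> as a function of
  \<open>y\<close>; see \<open>euler_sums\<close>.\<close>

definition euler_coeff :: "real \<Rightarrow> nat \<Rightarrow> real" where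
  "euler_coeff p n = (-1) ^ n * p ^ (n choose 2) / qpoch p p n"

text \<open>The index is an integer so that the convention \<open>1 / (p; p)\<^sub>i = 0\<close> for \<open>i < 0\<close> is available.\<close>

definition inv_qpoch :: "real \<Rightarrow> int \<Rightarrow> real" where
  "inv_qpoch p i = (if i < 0 then 0 else 1 / qpoch p p (nat i))"

text \<open>Unconditional convergence of real families is absolute, which makes the product family
  absolutely summable and so justifies summing it row by row.\<close>

lemma has_sum_product_real:
  fixes f :: "'a \<Rightarrow> real" and g :: "'b \<Rightarrow> real"
  assumes f: "(f has_sum S) A" and g: "(g has_sum T) B"
  shows "((\<lambda>(x, y). f x * g y) has_sum S * T) (A \<times> B)"
proof (rule has_sum_SigmaI)
  show "((\<lambda>y. case (x, y) of (x, y) \<Rightarrow> f x * g y) has_sum f x * T) B" for x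
    using has_sum_cmult_right[OF g] by simp
  show "((\<lambda>x. f x * T) has_sum S * T) A"
    using has_sum_cmult_left[OF f] by simp
  have f': "(\<lambda>x. \<bar>f x\<bar>) summable_on A" and g': "(\<lambda>x. \<bar>g x\<bar>) summable_on B"
    using f g summable_on_iff_abs_summable_on_real[of f A] summable_on_iff_abs_summable_on_real[of g B]
    by (auto simp: has_sum_imp_summable)
  have "(\<lambda>(x, y). \<bar>f x\<bar> * \<bar>g y\<bar>) summable_on A \<times> B"
  proof (rule summable_on_SigmaI)
    show "((\<lambda>y. case (x, y) of (x, y) \<Rightarrow> \<bar>f x\<bar> * \<bar>g y\<bar>) has_sum \<bar>f x\<bar> * infsum (\<lambda>y. \<bar>g y\<bar>) B) B" for x
      using has_sum_cmult_right[OF has_sum_infsum[OF g']] by simp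
    show "(\<lambda>x. \<bar>f x\<bar> * infsum (\<lambda>y. \<bar>g y\<bar>) B) summable_on A"
      using f' by (rule summable_on_cmult_left)
  qed auto
  then have "(\<lambda>z. norm ((\<lambda>(x, y). f x * g y) z)) summable_on A \<times> B"
    by (simp add: case_prod_unfold abs_mult)
  then show "(\<lambda>(x, y). f x * g y) summable_on A \<times> B"
    by (rule abs_summable_summable)
qed

lemmas summable_product_real = has_sum_imp_summable[OF has_sum_product_real[OF has_sum_infsum has_sum_infsum]]

context
  fixes p :: real
  assumes p: "0 < p" "p < 1"
begin

lemma qpoch_self_pos: "0 < qpoch p p n"
  unfolding qpoch_def
proof (rule prod_pos)
  fix k
  show "0 < 1 - p * p ^ k"
    using p power_Suc_less_one[of p k] by simp
qed

lemma abs_convergent_qpoch: "abs_convergent_prod (\<lambda>k. 1 - y * p ^ k)"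
  by (rule summable_imp_abs_convergent_prod) (use p in \<open>simp add: abs_mult\<close>)

lemma qpoch_LIMSEQ: "(\<lambda>n. qpoch y p n) \<longlonglongrightarrow> qpoch_inf y p"
proof -
  have "(\<lambda>n. \<Prod>k\<le>n. 1 - y * p ^ k) \<longlonglongrightarrow> qpoch_inf y p"
    unfolding qpoch_inf_def
    by (rule convergent_prod_LIMSEQ) (rule abs_convergent_prod_imp_convergent_prod[OF abs_convergent_qpoch])
  then have "(\<lambda>n. qpoch y p (Suc n)) \<longlonglongrightarrow> qpoch_inf y p"
    by (simp add: qpoch_def lessThan_Suc_atMost)
  then show ?thesis
    by (simp add: filterlim_sequentially_Suc)
qed

lemma qpoch_inf_split: "qpoch_inf y p = qpoch y p n * qpoch_inf (y * p ^ n) p"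
proof (rule LIMSEQ_unique)
  show "(\<lambda>k. qpoch y p (k + n)) \<longlonglongrightarrow> qpoch_inf y p"
    by (rule LIMSEQ_ignore_initial_segment[OF qpoch_LIMSEQ])
  show "(\<lambda>k. qpoch y p (k + n)) \<longlonglongrightarrow> qpoch y p n * qpoch_inf (y * p ^ n) p"
    by (subst add.commute, subst qpoch_add) (intro tendsto_intros qpoch_LIMSEQ)
qed

lemma qpoch_inf_nonzero:
  assumes "0 \<le> y" "y < 1"
  shows "qpoch_inf y p \<noteq> 0"
  unfolding qpoch_inf_def
proof (rule prodinf_nonzero)
  show "convergent_prod (\<lambda>k. 1 - y * p ^ k)"
    by (rule abs_convergent_prod_imp_convergent_prod[OF abs_convergent_qpoch])
  fix k
  have "y * p ^ k \<le> y * 1"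
    using assms p by (intro mult_left_mono power_le_one) auto
  then show "1 - y * p ^ k \<noteq> 0"
    using assms by linarith
qed

text \<open>The values \<open>1 / (p; p)_n\<close> converge because \<open>(p; p)_inf\<close> is
  nonzero. The bound is the dominating constant in the multiple series below.\<close>

lemma inv_qpoch_bounded: "\<exists>M. \<forall>i. \<bar>inv_qpoch p i\<bar> \<le> M"
proof -
  have "(\<lambda>n. 1 / qpoch p p n) \<longlonglongrightarrow> 1 / qpoch_inf p p"
    using p by (intro tendsto_intros qpoch_LIMSEQ qpoch_inf_nonzero) auto
  then obtain M where "0 < M" "\<And>n. norm (1 / qpoch p p n) \<le> M"
    by (meson BseqE convergentI convergent_imp_Bseq)
  then show ?thesis
    by (intro exI[of _ M]) (auto simp: inv_qpoch_def)
qed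

text \<open>The convention for negative indices fits the recursion: at \<open>i = 0\<close> the
  factor \<open>1 - p powi 0\<close> vanishes.\<close>

lemma inv_qpoch_minus_one: "inv_qpoch p (i - 1) = (1 - p powi i) * inv_qpoch p i"
proof (cases "i \<le> 0")
  case True
  then show ?thesis by (auto simp: inv_qpoch_def)
next
  case False
  then obtain n where "i = int (Suc n)"
    by (metis not_le zero_less_imp_eq_int gr0_implies_Suc)
  moreover have "1 - p * p ^ n \<noteq> 0"
    using p power_Suc_less_one[of p n] by simp
  ultimately show ?thesis
    using qpoch_self_pos[of n] by (simp add: inv_qpoch_def qpoch_Suc nat_add_distrib power_int_def)
qed

text \<open>For \<open>i < 0\<close> the numerator contains the factor
  \<open>1 - p powi 0 = 0\<close>; for \<open>i \<ge> 0\<close> the first \<open>i\<close> factors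
  of \<open>(p; p)_inf\<close> split off.\<close>

lemma inv_qpoch_eq_qpoch_inf:
  "inv_qpoch p i = qpoch_inf (p powi (i + 1)) p / qpoch_inf p p"
proof (cases "i < 0")
  case True
  then obtain n where n: "i + 1 = - int n"
    by (metis nonneg_int_cases zle_add1_eq_le add.commute neg_0_le_iff_le minus_minus zless_imp_add1_zle)
  have "qpoch_inf (p powi (i + 1)) p = 0"
    using qpoch_inf_split[of "p powi (i + 1)" "Suc n"] p
    by (simp add: n qpoch_Suc power_int_minus)
  then show ?thesis using True by (simp add: inv_qpoch_def)
next
  case False
  then have "0 \<le> i" by simp
  then obtain n where n: "i = int n" by (rule nonneg_int_cases)
  have "p powi (i + 1) = p * p ^ n"
    using p by (simp add: n power_int_add)
  moreover have "qpoch_inf p p = qpoch p p n * qpoch_inf (p * p ^ n) p"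
    by (rule qpoch_inf_split)
  moreover have "qpoch_inf p p \<noteq> 0"
    using p by (intro qpoch_inf_nonzero) auto
  ultimately show ?thesis
    by (simp add: n inv_qpoch_def)
qed

section \<open>Euler's expansion of the infinite product\<close>

lemma euler_coeff_0 [simp]: "euler_coeff p 0 = 1"
  by (simp add: euler_coeff_def qpoch_def binomial_eq_0)

lemma euler_coeff_Suc: "(1 - p ^ Suc n) * euler_coeff p (Suc n) = - (p ^ n) * euler_coeff p n"
proof -
  have "1 - p * p ^ n \<noteq> 0"
    using p power_Suc_less_one[of p n] by simp
  moreover have "Suc n choose 2 = n + (n choose 2)"
    by (simp add: numeral_2_eq_2)
  ultimately show ?thesis
    using qpoch_self_pos[of n]
    by (simp add: euler_coeff_def qpoch_Suc power_add field_simps)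
qed

lemma abs_summable_euler: "summable (\<lambda>n. \<bar>euler_coeff p n * y ^ n\<bar>)"
proof -
  \<comment> \<open>This is the ratio of consecutive absolute terms. Its limit 0 gives convergence
    for every \<open>y\<close>.\<close>
  have lim: "(\<lambda>n. p ^ n * \<bar>y\<bar> / (1 - p ^ Suc n)) \<longlonglongrightarrow> 0 * \<bar>y\<bar> / (1 - 0)"
    by (intro tendsto_intros LIMSEQ_realpow_zero LIMSEQ_Suc) (use p in auto)
  then have "eventually (\<lambda>n. p ^ n * \<bar>y\<bar> / (1 - p ^ Suc n) < 1 / 2) sequentially"
    by (intro order_tendstoD(2)[OF lim]) auto
  then obtain N where N: "\<And>n. n \<ge> N \<Longrightarrow> p ^ n * \<bar>y\<bar> / (1 - p ^ Suc n) < 1 / 2"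
    by (auto simp: eventually_sequentially)
  show ?thesis
  proof (rule summable_ratio_test)
    fix n assume n: "N \<le> n"
    have pos: "1 - p ^ Suc n > 0"
      using p power_Suc_less_one[of p n] by simp
    have "euler_coeff p (Suc n) = - (p ^ n) * euler_coeff p n / (1 - p ^ Suc n)"
      using euler_coeff_Suc[of n] pos by (simp add: field_simps)
    then have "\<bar>euler_coeff p (Suc n) * y ^ Suc n\<bar>
        = (p ^ n * \<bar>y\<bar> / (1 - p ^ Suc n)) * \<bar>euler_coeff p n * y ^ n\<bar>"
      using pos p by (simp add: abs_mult power_abs)
    also have "\<dots> \<le> 1 / 2 * \<bar>euler_coeff p n * y ^ n\<bar>"
      using N[OF n] by (intro mult_right_mono) auto
    finally show "norm \<bar>euler_coeff p (Suc n) * y ^ Suc n\<bar> \<le> 1 / 2 * norm \<bar>euler_coeff p n * y ^ n\<bar>"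
      by simp
  qed simp
qed

lemma euler_abs_summable_on: "(\<lambda>n. \<bar>euler_coeff p n * y ^ n\<bar>) summable_on UNIV"
  by (subst summable_on_UNIV_nonneg_real_iff) (simp_all only: abs_ge_zero abs_summable_euler)

text \<open>The recursion of the coefficients says that the series satisfies
  \<open>F y = (1 - y) * F (y * p)\<close>, as the product does. Iteration moves the argument to 0,
  where \<open>F\<close> is continuous with value 1.\<close>

lemma euler_sums: "(\<lambda>n. euler_coeff p n * y ^ n) sums qpoch_inf y p"
proof -
  define F where "F y = (\<Sum>n. euler_coeff p n * y ^ n)" for y
  have sm: "summable (\<lambda>n. euler_coeff p n * y ^ n)" for y
    using abs_summable_euler[of y] by (rule summable_rabs_cancel)
  have rec: "F y = (1 - y) * F (y * p)" for y
  proof -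
    have "F y - F (y * p) = (\<Sum>n. (1 - p ^ n) * euler_coeff p n * y ^ n)"
      unfolding F_def by (subst suminf_diff[OF sm sm]) (simp add: algebra_simps power_mult_distrib)
    also have "\<dots> = (\<Sum>n. (1 - p ^ Suc n) * euler_coeff p (Suc n) * y ^ Suc n)"
    proof (subst suminf_split_head)
      show "summable (\<lambda>n. (1 - p ^ n) * euler_coeff p n * y ^ n)"
        using summable_diff[OF sm[of y] sm[of "y * p"]] by (simp add: algebra_simps power_mult_distrib)
    qed simp
    also have "\<dots> = (\<Sum>n. (- y) * (euler_coeff p n * (y * p) ^ n))"
      by (subst euler_coeff_Suc) (simp add: power_mult_distrib mult_ac)
    also have "\<dots> = - y * F (y * p)"
      unfolding F_def using sm by (rule suminf_mult)
    finally show ?thesis by (simp add: algebra_simps)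
  qed
  have iter: "F y = qpoch y p N * F (y * p ^ N)" for N
  proof (induction N)
    case 0
    then show ?case by (simp add: qpoch_def)
  next
    case (Suc N)
    then show ?case using rec[of "y * p ^ N"] by (simp add: qpoch_Suc mult_ac)
  qed
  have "isCont F 0"
    unfolding F_def by (rule isCont_powser[where K = 1]) (use sm[of 1] in auto)
  moreover have "(\<lambda>N. y * p ^ N) \<longlonglongrightarrow> y * 0"
    by (intro tendsto_intros LIMSEQ_realpow_zero) (use p in auto)
  ultimately have "(\<lambda>N. F (y * p ^ N)) \<longlonglongrightarrow> F 0"
    by (intro isCont_tendsto_compose[where g = F]) simp_all
  then have "(\<lambda>N. qpoch y p N * F (y * p ^ N)) \<longlonglongrightarrow> qpoch_inf y p * F 0"
    by (intro tendsto_mult qpoch_LIMSEQ)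
  then have "F y = qpoch_inf y p * F 0"
    unfolding iter[symmetric] by (simp add: LIMSEQ_const_iff)
  moreover have "F 0 = 1"
    unfolding F_def using powser_zero[of "euler_coeff p"] by simp
  ultimately show ?thesis
    using sm unfolding F_def by (simp add: sums_iff)
qed

lemma euler_has_sum: "((\<lambda>n. euler_coeff p n * y ^ n) has_sum qpoch_inf y p) UNIV"
  by (rule norm_summable_imp_has_sum) (use abs_summable_euler euler_sums in auto)

text \<open>The coefficients of \<open>(y; p)\<^sub>\<infinity>\<close> and of its reciprocal are convolution inverses.\<close>

lemma euler_convolution:
  "((\<lambda>n. euler_coeff p n * inv_qpoch p (s - int n)) has_sum (if s = 0 then 1 else 0)) UNIV"
proof -
  define T where "T s = (\<Sum>n\<le>s. euler_coeff p n * inv_qpoch p (int s - int n))" for s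
  have rec: "(1 - p ^ Suc s) * T (Suc s) = (1 - p ^ s) * T s" for s
  proof -
    let ?i = "\<lambda>n. int (Suc s) - int n"
    \<comment> \<open>With \<open>x = p powi ?i n\<close> and \<open>y = p ^ n\<close>, the factor
      \<open>1 - x * y\<close> is split as \<open>(1 - x) + x * (1 - y)\<close>: the first part
      lowers the index of \<open>inv_qpoch\<close>, the second that of
      \<open>euler_coeff\<close>.\<close>
    have "(1 - p ^ Suc s) * T (Suc s)
        = (\<Sum>n\<le>Suc s. euler_coeff p n * ((1 - p powi ?i n) * inv_qpoch p (?i n)))
          + (\<Sum>n\<le>Suc s. p powi ?i n * ((1 - p ^ n) * euler_coeff p n) * inv_qpoch p (?i n))"
      unfolding T_def sum_distrib_left sum.distrib[symmetric]
    proof (rule sum.cong[OF refl])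
      fix n
      have "p ^ Suc s = p powi ?i n * p powi int n"
        using p by (subst power_int_add[symmetric]) (auto simp flip: power_int_of_nat)
      then have split: "p ^ Suc s = p powi ?i n * p ^ n" by simp
      have "(1 - x * y) * (e * A) = e * ((1 - x) * A) + x * ((1 - y) * e) * A" for x y e A :: real
        by algebra
      then show "(1 - p ^ Suc s) * (euler_coeff p n * inv_qpoch p (?i n))
          = euler_coeff p n * ((1 - p powi ?i n) * inv_qpoch p (?i n))
            + p powi ?i n * ((1 - p ^ n) * euler_coeff p n) * inv_qpoch p (?i n)"
        unfolding split .
    qed
    also have "(\<Sum>n\<le>Suc s. euler_coeff p n * ((1 - p powi ?i n) * inv_qpoch p (?i n))) = T s"
      unfolding T_def inv_qpoch_minus_one[symmetric]
      by (subst sum.atMost_Suc) (simp add: inv_qpoch_def algebra_simps)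
    also have "(\<Sum>n\<le>Suc s. p powi ?i n * ((1 - p ^ n) * euler_coeff p n) * inv_qpoch p (?i n))
        = (\<Sum>n\<le>s. p powi (int s - int n) * ((1 - p ^ Suc n) * euler_coeff p (Suc n)) * inv_qpoch p (int s - int n))"
      by (subst sum.atMost_Suc_shift) simp
    also have "\<dots> = (\<Sum>n\<le>s. - (p ^ s) * (euler_coeff p n * inv_qpoch p (int s - int n)))"
    proof (rule sum.cong[OF refl])
      fix n
      have "p ^ s = p powi (int s - int n) * p powi int n"
        using p by (subst power_int_add[symmetric]) auto
      then have "p ^ s = p powi (int s - int n) * p ^ n" by simp
      then show "p powi (int s - int n) * ((1 - p ^ Suc n) * euler_coeff p (Suc n)) * inv_qpoch p (int s - int n)
          = - (p ^ s) * (euler_coeff p n * inv_qpoch p (int s - int n))"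
        by (subst euler_coeff_Suc) simp
    qed
    also have "\<dots> = - (p ^ s) * T s"
      by (simp add: T_def sum_distrib_left)
    finally show ?thesis by (simp add: algebra_simps)
  qed
  have T: "T s = (if s = 0 then 1 else 0)" for s
  proof (induction s)
    case 0
    then show ?case by (simp add: T_def inv_qpoch_def qpoch_def)
  next
    case (Suc s)
    have "1 - p ^ Suc s \<noteq> 0"
      using p power_Suc_less_one[of p s] by simp
    \<comment> \<open>At \<open>s = 0\<close> the first factor vanishes, which makes
      \<open>T 1\<close> zero; from then on \<open>T s\<close> is zero by induction.\<close>
    moreover have "(1 - p ^ s) * T s = 0"
      using Suc by (cases "s = 0") simp_all
    ultimately show ?case
      using rec[of s] by (metis mult_eq_0_iff nat.distinct(1))
  qed
  show ?thesis
  proof (cases "s < 0")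
    case True
    then show ?thesis by (simp add: inv_qpoch_def)
  next
    case False
    then have "0 \<le> s" by simp
    then obtain t where t: "s = int t" by (rule nonneg_int_cases)
    show ?thesis
    proof (rule has_sum_finite_neutralI)
      show "(if s = 0 then 1 else 0) = (\<Sum>n\<le>t. euler_coeff p n * inv_qpoch p (s - int n))"
        using T[of t] unfolding T_def t by simp
    qed (auto simp: t inv_qpoch_def)
  qed
qed

end

section \<open>Bessel coefficients and their orthogonality\<close>

text \<open>The coefficient of \<open>t^k\<close> in \<open>(b/t; p)_inf / (t; p)_inf\<close>:
  Euler's series supplies \<open>t^(-n)\<close>, the reciprocal product
  \<open>t^(k + n)\<close>.\<close>

definition bessel_coeff :: "real \<Rightarrow> real \<Rightarrow> int \<Rightarrow> real" where
  "bessel_coeff p b k = (\<Sum>\<^sub>\<infinity>n. euler_coeff p n * b ^ n * inv_qpoch p (k + int n))"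

context
  fixes p :: real
  assumes p: "0 < p" "p < 1"
begin

lemma bessel_coeff_has_sum:
  "((\<lambda>n. euler_coeff p n * b ^ n * inv_qpoch p (k + int n)) has_sum bessel_coeff p b k) UNIV"
proof -
  obtain M where M: "\<And>i. \<bar>inv_qpoch p i\<bar> \<le> M"
    using inv_qpoch_bounded[OF p] by blast
  have "(\<lambda>n. \<bar>euler_coeff p n * b ^ n\<bar> * M) summable_on UNIV"
    by (intro summable_on_cmult_left euler_abs_summable_on p)
  then have "(\<lambda>n. norm (euler_coeff p n * b ^ n * inv_qpoch p (k + int n))) summable_on UNIV"
  proof (rule Infinite_Sum.abs_summable_on_comparison_test')
    fix n
    show "norm (euler_coeff p n * b ^ n * inv_qpoch p (k + int n)) \<le> \<bar>euler_coeff p n * b ^ n\<bar> * M"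
      unfolding real_norm_def abs_mult[of "euler_coeff p n * b ^ n"] by (intro mult_left_mono M) simp
  qed
  then show ?thesis
    unfolding bessel_coeff_def by (rule has_sum_infsum[OF abs_summable_summable])
qed

text \<open>Termwise this is \<open>inv_qpoch_minus_one\<close>: of the factor
  \<open>p powi (k + 1 + n)\<close> the part \<open>p ^ n\<close> turns \<open>b ^ n\<close> into
  \<open>(b * p) ^ n\<close>. For \<open>p = q^2\<close> and \<open>b = a^2\<close> the difference
  raises the order, from \<open>a\<close> to \<open>a * q\<close>.\<close>

lemma bessel_coeff_diff:
  "bessel_coeff p b (k + 1) - bessel_coeff p b k = p powi (k + 1) * bessel_coeff p (b * p) (k + 1)"
proof (rule has_sum_unique)
  let ?f = "\<lambda>n. euler_coeff p n * b ^ n * inv_qpoch p (k + 1 + int n)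
              + - (euler_coeff p n * b ^ n * inv_qpoch p (k + int n))"
  show "(?f has_sum (bessel_coeff p b (k + 1) - bessel_coeff p b k)) UNIV"
    unfolding diff_conv_add_uminus by (intro has_sum_add has_sum_uminusI bessel_coeff_has_sum)
  have "?f n = p powi (k + 1) * (euler_coeff p n * (b * p) ^ n * inv_qpoch p (k + 1 + int n))" for n
  proof -
    have shift: "inv_qpoch p (k + int n) = (1 - p powi (k + 1) * p ^ n) * inv_qpoch p (k + 1 + int n)"
      using inv_qpoch_minus_one[OF p, of "k + 1 + int n"] p
      by (simp add: power_int_add[of p "k + 1" "int n"])
    show ?thesis
      unfolding shift power_mult_distrib by (simp add: algebra_simps)
  qed
  then show "(?f has_sum (p powi (k + 1) * bessel_coeff p (b * p) (k + 1))) UNIV"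
    by (simp only: ) (intro has_sum_cmult_right bessel_coeff_has_sum)
qed

text \<open>Expanding the infinite product makes the sum symmetric in \<open>x\<close> and \<open>y\<close>.\<close>

lemma euler_double_sum_symmetric:
  "\<exists>S. ((\<lambda>n. euler_coeff p n * x ^ n * qpoch_inf (y * p ^ n) p) has_sum S) UNIV
     \<and> ((\<lambda>n. euler_coeff p n * y ^ n * qpoch_inf (x * p ^ n) p) has_sum S) UNIV"
proof -
  define G where "G = (\<lambda>(n, m). euler_coeff p n * x ^ n * (euler_coeff p m * (y * p ^ n) ^ m))"
  have "(\<lambda>(n, m). \<bar>euler_coeff p n * x ^ n\<bar> * \<bar>euler_coeff p m * y ^ m\<bar>) summable_on UNIV \<times> UNIV"
    by (intro summable_product_real euler_abs_summable_on p)
  then have "(\<lambda>z. norm (G z)) summable_on UNIV \<times> UNIV"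
  proof (rule Infinite_Sum.abs_summable_on_comparison_test')
    fix z :: "nat \<times> nat"
    obtain n m where z: "z = (n, m)" by (cases z)
    have "norm (G z) = \<bar>euler_coeff p n * x ^ n\<bar> * (\<bar>euler_coeff p m * y ^ m\<bar> * (p ^ n) ^ m)"
      using p by (simp add: G_def z abs_mult power_abs power_mult_distrib)
    \<comment> \<open>The coupling factor \<open>p^(n m)\<close> is at most 1, so a product of two
      Euler series dominates.\<close>
    also have "\<dots> \<le> \<bar>euler_coeff p n * x ^ n\<bar> * (\<bar>euler_coeff p m * y ^ m\<bar> * 1)"
      using p by (intro mult_left_mono power_le_one) auto
    finally show "norm (G z) \<le> (case z of (n, m) \<Rightarrow> \<bar>euler_coeff p n * x ^ n\<bar> * \<bar>euler_coeff p m * y ^ m\<bar>)"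
      by (simp add: z)
  qed
  then have S: "(G has_sum infsum G (UNIV \<times> UNIV)) (UNIV \<times> UNIV)"
    by (rule has_sum_infsum[OF abs_summable_summable])
  have "((\<lambda>n. euler_coeff p n * x ^ n * qpoch_inf (y * p ^ n) p) has_sum infsum G (UNIV \<times> UNIV)) UNIV"
    by (rule has_sum_SigmaD[OF S])
      (simp only: G_def prod.case, intro has_sum_cmult_right euler_has_sum p)
  moreover have "((\<lambda>n. euler_coeff p n * y ^ n * qpoch_inf (x * p ^ n) p) has_sum infsum G (UNIV \<times> UNIV)) UNIV"
  proof (rule has_sum_SigmaD[OF S[unfolded has_sum_swap[of G]]])
    fix m
    have "((\<lambda>n. euler_coeff p m * y ^ m * (euler_coeff p n * (x * p ^ m) ^ n))
        has_sum euler_coeff p m * y ^ m * qpoch_inf (x * p ^ m) p) UNIV"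
      by (intro has_sum_cmult_right euler_has_sum p)
    then show "((\<lambda>n. case (m, n) of (x, y) \<Rightarrow> G (y, x))
        has_sum euler_coeff p m * y ^ m * qpoch_inf (x * p ^ m) p) UNIV"
      by (simp add: G_def power_mult_distrib mult_ac power_mult[symmetric])
  qed
  ultimately show ?thesis by blast
qed

text \<open>Writing \<open>inv_qpoch\<close> as a quotient of infinite products allows
  \<open>b\<close> and \<open>p powi (k + 1)\<close> to be exchanged. The result is a power series
  in \<open>p powi k\<close>, which can be compared with \<open>qbessel_j\<close>.\<close>

lemma bessel_coeff_expansion:
  "((\<lambda>n. euler_coeff p n * (p powi (k + 1)) ^ n * qpoch_inf (b * p ^ n) p)
     has_sum qpoch_inf p p * bessel_coeff p b k) UNIV"
proof -
  have nz: "qpoch_inf p p \<noteq> 0"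
    using p by (intro qpoch_inf_nonzero) auto
  have "qpoch_inf p p * (euler_coeff p n * b ^ n * inv_qpoch p (k + int n))
      = euler_coeff p n * b ^ n * qpoch_inf (p powi (k + 1) * p ^ n) p" for n
  proof -
    have "p powi (k + int n + 1) = p powi (k + 1) * p ^ n"
      using p power_int_add[of p "k + 1" "int n"] by (simp add: add_ac)
    then show ?thesis
      using nz by (simp add: inv_qpoch_eq_qpoch_inf[OF p])
  qed
  then have "((\<lambda>n. euler_coeff p n * b ^ n * qpoch_inf (p powi (k + 1) * p ^ n) p)
      has_sum qpoch_inf p p * bessel_coeff p b k) UNIV"
    using has_sum_cmult_right[OF bessel_coeff_has_sum, of "qpoch_inf p p" b k] by (simp only: )
  then show ?thesis
    using euler_double_sum_symmetric[of b "p powi (k + 1)"] has_sum_unique by blast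
qed

lemma inv_qpoch_powi_abs_summable:
  assumes b: "0 < b" "b < 1"
  shows "(\<lambda>i. \<bar>b powi i * inv_qpoch p i\<bar>) summable_on UNIV"
proof -
  obtain M where M: "\<And>i. \<bar>inv_qpoch p i\<bar> \<le> M"
    using inv_qpoch_bounded[OF p] by blast
  have "(\<lambda>n. b ^ n) summable_on (UNIV :: nat set)"
    using b by (subst summable_on_UNIV_nonneg_real_iff) auto
  then have "(\<lambda>n. b ^ n * M) summable_on (UNIV :: nat set)"
    by (rule summable_on_cmult_left)
  then have "(\<lambda>n. norm (b powi int n * inv_qpoch p (int n))) summable_on UNIV"
  proof (rule Infinite_Sum.abs_summable_on_comparison_test')
    fix n
    show "norm (b powi int n * inv_qpoch p (int n)) \<le> b ^ n * M"
      using b M[of "int n"] by (simp add: abs_mult)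
  qed
  then have "(\<lambda>i. \<bar>b powi i * inv_qpoch p i\<bar>) summable_on range int"
    by (subst summable_on_reindex) (simp_all add: o_def)
  then show ?thesis
  proof (rule summable_on_cong_neutral[THEN iffD1, rotated -1])
    fix i :: int
    assume "i \<in> UNIV - range int"
    then have "i < 0" by (metis DiffD2 nonneg_int_cases not_less rangeI)
    then show "\<bar>b powi i * inv_qpoch p i\<bar> = 0" by (simp add: inv_qpoch_def)
  qed auto
qed

text \<open>The coefficients of \<open>t \<mapsto> (b/t; p)\<^sub>\<infinity> / (t; p)\<^sub>\<infinity>\<close> are the Bessel coefficients;
  the function takes reciprocal values at \<open>t\<close> and \<open>b/t\<close>, which is the identity below.\<close>

lemma bessel_coeff_orthogonal:
  assumes b: "0 < b" "b < 1"
  shows "((\<lambda>k. b powi k * (bessel_coeff p b k * bessel_coeff p b (k + l)))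
           has_sum (if l = 0 then 1 else 0)) UNIV"
proof -
  \<comment> \<open>This is the triple series of the claim after substituting
    \<open>i = k + n\<close>: the powers \<open>b^k\<close> and \<open>b^n\<close> merge into
    \<open>b^i\<close>, and the sum over \<open>n\<close> becomes a convolution.\<close>
  define G where "G = (\<lambda>((i, m), n). b powi i * inv_qpoch p i * (euler_coeff p m * b ^ m)
      * (euler_coeff p n * inv_qpoch p (int m + i + l - int n)))"
  obtain M where M: "\<And>i. \<bar>inv_qpoch p i\<bar> \<le> M"
    using inv_qpoch_bounded[OF p] by blast
  \<comment> \<open>Only one \<open>inv_qpoch\<close> is bounded by \<open>M\<close>; the other is
    summable in \<open>i\<close> against \<open>b powi i\<close>, because \<open>b < 1\<close>. The
    power \<open>1 ^ n\<close> matches the form of \<open>euler_abs_summable_on\<close>.\<close>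
  have "(\<lambda>(z, n). (case z of (i, m) \<Rightarrow> \<bar>b powi i * inv_qpoch p i\<bar> * \<bar>euler_coeff p m * b ^ m\<bar>)
      * (\<bar>euler_coeff p n * 1 ^ n\<bar> * M)) summable_on (UNIV \<times> UNIV) \<times> UNIV"
    by (intro summable_product_real inv_qpoch_powi_abs_summable summable_on_cmult_left
        euler_abs_summable_on p b)
  then have "(\<lambda>z. norm (G z)) summable_on (UNIV \<times> UNIV) \<times> UNIV"
  proof (rule Infinite_Sum.abs_summable_on_comparison_test')
    fix z :: "(int \<times> nat) \<times> nat"
    obtain i m n where z: "z = ((i, m), n)" by (metis prod.exhaust)
    have "norm (G z) = \<bar>b powi i * inv_qpoch p i\<bar> * \<bar>euler_coeff p m * b ^ m\<bar>
        * (\<bar>euler_coeff p n\<bar> * \<bar>inv_qpoch p (int m + i + l - int n)\<bar>)"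
      by (simp add: G_def z abs_mult)
    also have "\<dots> \<le> \<bar>b powi i * inv_qpoch p i\<bar> * \<bar>euler_coeff p m * b ^ m\<bar> * (\<bar>euler_coeff p n\<bar> * M)"
      by (intro mult_left_mono M) auto
    finally show "norm (G z) \<le> (case z of (z, n) \<Rightarrow>
        (case z of (i, m) \<Rightarrow> \<bar>b powi i * inv_qpoch p i\<bar> * \<bar>euler_coeff p m * b ^ m\<bar>)
        * (\<bar>euler_coeff p n * 1 ^ n\<bar> * M))"
      by (simp add: z)
  qed
  then have "(G has_sum infsum G ((UNIV \<times> UNIV) \<times> UNIV)) ((UNIV \<times> UNIV) \<times> UNIV)"
    by (rule has_sum_infsum[OF abs_summable_summable])
  then obtain S where S: "(G has_sum S) ((UNIV \<times> UNIV) \<times> UNIV)"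
    by blast
  \<comment> \<open>The sum over \<open>n\<close> is a convolution and leaves only the terms with
    \<open>i = - l - m\<close>.\<close>
  have "((\<lambda>(i, m). b powi i * inv_qpoch p i * (euler_coeff p m * b ^ m)
      * (if int m + i + l = 0 then 1 else 0)) has_sum S) (UNIV \<times> UNIV)"
    by (rule has_sum_SigmaD[OF S])
      (clarsimp simp only: G_def prod.case, intro has_sum_cmult_right euler_convolution p)
  then have "((\<lambda>(m, i). b powi i * inv_qpoch p i * (euler_coeff p m * b ^ m)
      * (if int m + i + l = 0 then 1 else 0)) has_sum S) (UNIV \<times> UNIV)"
    by (subst has_sum_swap) simp
  \<comment> \<open>On these terms \<open>b^i * b^m = b^(-l)\<close>, and the sum over
    \<open>m\<close> is again a convolution.\<close>
  then have "((\<lambda>m. b powi (- l) * (euler_coeff p m * inv_qpoch p (- l - int m))) has_sum S) UNIV"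
  proof (rule has_sum_SigmaD)
    fix m
    have "b powi (- l) = b powi (- l - int m) * b ^ m"
      using b power_int_add[of b "- l - int m" "int m"] by simp
    then show "((\<lambda>i. case (m, i) of (m, i) \<Rightarrow> b powi i * inv_qpoch p i * (euler_coeff p m * b ^ m)
        * (if int m + i + l = 0 then 1 else 0))
        has_sum b powi (- l) * (euler_coeff p m * inv_qpoch p (- l - int m))) UNIV"
      by (intro has_sum_finite_neutralI[where B = "{- l - int m}"]) auto
  qed
  moreover have "((\<lambda>m. b powi (- l) * (euler_coeff p m * inv_qpoch p (- l - int m)))
      has_sum b powi (- l) * (if - l = 0 then 1 else 0)) UNIV"
    by (intro has_sum_cmult_right euler_convolution p)
  ultimately have "S = b powi (- l) * (if - l = 0 then 1 else 0)"
    by (rule has_sum_unique)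
  then have S_eq: "S = (if l = 0 then 1 else 0)" by simp
  \<comment> \<open>Undoing the substitution and summing over \<open>n\<close> and \<open>m\<close>
    first recovers the products of Bessel coefficients.\<close>
  have bij: "bij_betw (\<lambda>(k, n, m). ((k + int n, m), n)) (UNIV \<times> UNIV \<times> UNIV) ((UNIV \<times> UNIV) \<times> UNIV)"
    by (rule bij_betw_byWitness[where f' = "\<lambda>((i, m), n). (i - int n, n, m)"]) auto
  have "((\<lambda>z. G (case z of (k, n, m) \<Rightarrow> ((k + int n, m), n))) has_sum S) (UNIV \<times> UNIV \<times> UNIV)"
    using S by (subst has_sum_reindex_bij_betw[OF bij])
  then have "((\<lambda>k. b powi k * (bessel_coeff p b k * bessel_coeff p b (k + l))) has_sum S) UNIV"
  proof (rule has_sum_SigmaD)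
    fix k :: int
    let ?g = "\<lambda>(n, m). euler_coeff p n * b ^ n * inv_qpoch p (k + int n)
        * (euler_coeff p m * b ^ m * inv_qpoch p (k + l + int m))"
    have "((\<lambda>z. b powi k * ?g z) has_sum b powi k * (bessel_coeff p b k * bessel_coeff p b (k + l)))
        (UNIV \<times> UNIV)"
      by (intro has_sum_cmult_right has_sum_product_real bessel_coeff_has_sum)
    moreover have "b powi k * ?g z = G (case (k, z) of (k, n, m) \<Rightarrow> ((k + int n, m), n))" for z
      using b by (cases z) (simp add: G_def power_int_add algebra_simps)
    ultimately show "((\<lambda>z. G (case (k, z) of (k, n, m) \<Rightarrow> ((k + int n, m), n)))
        has_sum b powi k * (bessel_coeff p b k * bessel_coeff p b (k + l))) (UNIV \<times> UNIV)"
      by simp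
  qed
  then show ?thesis unfolding S_eq .
qed

end

section \<open>Orthonormal families of square-summable sequences\<close>

lemma square_summable_mult:
  fixes u w :: "'a \<Rightarrow> real"
  assumes "(\<lambda>n. (u n)\<^sup>2) summable_on A" "(\<lambda>n. (w n)\<^sup>2) summable_on A"
  shows "(\<lambda>n. u n * w n) summable_on A"
  by (rule abs_summable_summable, rule abs_summable_product)
    (use assms in \<open>simp_all add: power2_eq_square\<close>)

lemma has_sum_Cauchy_Schwarz:
  fixes u w :: "'a \<Rightarrow> real"
  assumes uw: "((\<lambda>n. u n * w n) has_sum S) A"
    and u: "((\<lambda>n. (u n)\<^sup>2) has_sum U) A" and w: "((\<lambda>n. (w n)\<^sup>2) has_sum W) A"
  shows "\<bar>S\<bar> \<le> sqrt U * sqrt W"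
proof (rule tendsto_upperbound)
  show "((\<lambda>F. \<bar>\<Sum>n\<in>F. u n * w n\<bar>) \<longlongrightarrow> \<bar>S\<bar>) (finite_subsets_at_top A)"
    using uw unfolding has_sum_def by (rule tendsto_rabs)
  have "\<bar>\<Sum>n\<in>F. u n * w n\<bar> \<le> sqrt U * sqrt W" if F: "finite F" "F \<subseteq> A" for F
  proof -
    have "\<bar>\<Sum>n\<in>F. u n * w n\<bar> \<le> (\<Sum>n\<in>F. \<bar>u n\<bar> * \<bar>w n\<bar>)"
      using sum_abs[of "\<lambda>n. u n * w n" F] by (simp add: abs_mult)
    also have "\<dots> \<le> L2_set u F * L2_set w F"
      by (rule L2_set_mult_ineq)
    also have "\<dots> \<le> sqrt U * sqrt W"
      unfolding L2_set_def
      using finite_sum_le_has_sum[OF u F] finite_sum_le_has_sum[OF w F] has_sum_nonneg[OF u]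
      by (intro mult_mono real_sqrt_le_mono real_sqrt_ge_zero sum_nonneg) auto
    finally show ?thesis .
  qed
  then show "\<forall>\<^sub>F F in finite_subsets_at_top A. \<bar>\<Sum>n\<in>F. u n * w n\<bar> \<le> sqrt U * sqrt W"
    by (auto simp: eventually_finite_subsets_at_top)
qed simp

lemma has_sum_sum:
  fixes f :: "'i \<Rightarrow> 'a \<Rightarrow> real"
  assumes "finite F" "\<And>i. i \<in> F \<Longrightarrow> (f i has_sum S i) A"
  shows "((\<lambda>n. \<Sum>i\<in>F. f i n) has_sum (\<Sum>i\<in>F. S i)) A"
  using assms by (induction F) (auto intro: has_sum_add)

context
  fixes e :: "'i \<Rightarrow> 'a \<Rightarrow> real" and w :: "'a \<Rightarrow> real" and c :: "'i \<Rightarrow> real" and W :: real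
  assumes orth: "\<And>i j. ((\<lambda>n. e i n * e j n) has_sum (if i = j then 1 else 0)) UNIV"
    and w: "((\<lambda>n. (w n)\<^sup>2) has_sum W) UNIV"
    and c: "\<And>i. ((\<lambda>n. e i n * w n) has_sum c i) UNIV"
begin

text \<open>Orthonormality collapses the double sum of the expanded square to its diagonal.
  Nonnegativity of the residual yields Bessel's inequality, and its exact value yields convergence
  in \<open>hankel_inversion\<close>.\<close>

lemma orthonormal_residual:
  assumes "finite F"
  shows "((\<lambda>n. (w n - (\<Sum>i\<in>F. c i * e i n))\<^sup>2) has_sum W - (\<Sum>i\<in>F. (c i)\<^sup>2)) UNIV"
proof -
  have "((\<lambda>n. (w n)\<^sup>2 + - 2 * (\<Sum>i\<in>F. c i * (e i n * w n)) + (\<Sum>i\<in>F. \<Sum>j\<in>F. c i * c j * (e i n * e j n)))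
      has_sum W + - 2 * (\<Sum>i\<in>F. c i * c i) + (\<Sum>i\<in>F. \<Sum>j\<in>F. c i * c j * (if i = j then 1 else 0))) UNIV"
    by (intro has_sum_add has_sum_cmult_right has_sum_sum assms w c orth)
  moreover have "(w n)\<^sup>2 + - 2 * (\<Sum>i\<in>F. c i * (e i n * w n)) + (\<Sum>i\<in>F. \<Sum>j\<in>F. c i * c j * (e i n * e j n))
      = (w n - (\<Sum>i\<in>F. c i * e i n))\<^sup>2" for n
  proof -
    have "(\<Sum>i\<in>F. \<Sum>j\<in>F. c i * c j * (e i n * e j n)) = (\<Sum>i\<in>F. c i * e i n)\<^sup>2"
      by (simp add: power2_eq_square sum_product mult_ac)
    moreover have "(\<Sum>i\<in>F. c i * (e i n * w n)) = (\<Sum>i\<in>F. c i * e i n) * w n"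
      by (simp add: sum_distrib_right mult.assoc)
    ultimately show ?thesis by (simp add: power2_diff)
  qed
  moreover have "(\<Sum>i\<in>F. \<Sum>j\<in>F. c i * c j * (if i = j then 1 else 0)) = (\<Sum>i\<in>F. (c i)\<^sup>2)"
    using assms by (intro sum.cong refl) (simp add: power2_eq_square if_distrib sum.delta cong: if_cong)
  ultimately show ?thesis
    by (simp add: power2_eq_square)
qed

lemma Bessel_inequality:
  "(\<lambda>i. (c i)\<^sup>2) summable_on UNIV" "(\<Sum>\<^sub>\<infinity>i. (c i)\<^sup>2) \<le> W"
proof -
  have le: "(\<Sum>i\<in>F. (c i)\<^sup>2) \<le> W" if "finite F" for F
    using has_sum_nonneg[OF orthonormal_residual[OF that]] by simp
  show sm: "(\<lambda>i. (c i)\<^sup>2) summable_on UNIV"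
    by (rule nonneg_bdd_above_summable_on) (auto intro!: bdd_aboveI2 le)
  show "(\<Sum>\<^sub>\<infinity>i. (c i)\<^sup>2) \<le> W"
    by (rule infsum_le_finite_sums[OF sm]) (use le in auto)
qed

end

text \<open>The unit vector at \<open>m\<close> has Fourier coefficients \<open>J (m + i)\<close> in the orthonormal family of the
  translates of \<open>J\<close>, whose squares sum to 1: Parseval's identity holds for it, so that the expansion converges.\<close>

lemma hankel_inversion:
  fixes J u v :: "int \<Rightarrow> real"
  assumes orth: "\<And>i j. ((\<lambda>n. J (i + n) * J (j + n)) has_sum (if i = j then 1 else 0)) UNIV"
    and u: "(\<lambda>n. (u n)\<^sup>2) summable_on UNIV"
    and v: "\<And>i. ((\<lambda>n. J (i + n) * u n) has_sum v i) UNIV"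
  shows "((\<lambda>i. J (m + i) * v i) has_sum u m) UNIV"
proof -
  define d where "d = (\<lambda>n. if n = m then 1 else 0 :: real)"
  define U where "U = (\<Sum>\<^sub>\<infinity>n. (u n)\<^sup>2)"
  have U: "((\<lambda>n. (u n)\<^sup>2) has_sum U) UNIV"
    unfolding U_def using u by (rule has_sum_infsum)
  have d2: "((\<lambda>n. (d n)\<^sup>2) has_sum 1) UNIV"
    by (rule has_sum_finite_neutralI[where B = "{m}"]) (auto simp: d_def)
  have dJ: "((\<lambda>n. J (i + n) * d n) has_sum J (m + i)) UNIV" for i
    by (rule has_sum_finite_neutralI[where B = "{m}"]) (auto simp: d_def add.commute)
  have du: "((\<lambda>n. d n * u n) has_sum u m) UNIV"
    by (rule has_sum_finite_neutralI[where B = "{m}"]) (auto simp: d_def)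
  \<comment> \<open>The left side is the inner product of \<open>u\<close> with the residual of
    \<open>d\<close>, whose squared norm is known exactly; Cauchy--Schwarz applies.\<close>
  have bound: "\<bar>u m - (\<Sum>i\<in>F. J (m + i) * v i)\<bar> \<le> sqrt (1 - (\<Sum>i\<in>F. (J (m + i))\<^sup>2)) * sqrt U"
    if F: "finite F" for F
  proof (rule has_sum_Cauchy_Schwarz)
    have "((\<lambda>n. d n * u n + - (\<Sum>i\<in>F. J (m + i) * (J (i + n) * u n)))
        has_sum u m + - (\<Sum>i\<in>F. J (m + i) * v i)) UNIV"
      by (intro has_sum_add du has_sum_uminusI has_sum_sum F has_sum_cmult_right v)
    then show "((\<lambda>n. (d n - (\<Sum>i\<in>F. J (m + i) * J (i + n))) * u n)
        has_sum u m - (\<Sum>i\<in>F. J (m + i) * v i)) UNIV"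
      by (simp add: left_diff_distrib sum_distrib_right mult.assoc)
    show "((\<lambda>n. (d n - (\<Sum>i\<in>F. J (m + i) * J (i + n)))\<^sup>2) has_sum 1 - (\<Sum>i\<in>F. (J (m + i))\<^sup>2)) UNIV"
      by (rule orthonormal_residual[OF orth d2 dJ F])
  qed (rule U)
  \<comment> \<open>By Hankel symmetry the Fourier coefficients of \<open>d\<close> are the entries
    of row \<open>m\<close>, which has norm 1, so the residual tends to 0.\<close>
  have "((\<lambda>F. sqrt (1 - (\<Sum>i\<in>F. (J (m + i))\<^sup>2)) * sqrt U) \<longlongrightarrow> sqrt (1 - 1) * sqrt U)
      (finite_subsets_at_top UNIV)"
    using orth[of m m] unfolding has_sum_def by (intro tendsto_intros) (simp add: power2_eq_square)
  then have lim: "((\<lambda>F. sqrt (1 - (\<Sum>i\<in>F. (J (m + i))\<^sup>2)) * sqrt U) \<longlongrightarrow> 0) (finite_subsets_at_top UNIV)"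
    by simp
  have "((\<lambda>F. u m - (\<Sum>i\<in>F. J (m + i) * v i)) \<longlongrightarrow> 0) (finite_subsets_at_top UNIV)"
    by (rule Lim_null_comparison[OF _ lim])
      (use bound in \<open>auto simp: eventually_finite_subsets_at_top\<close>)
  then have "((\<lambda>F. u m - (u m - (\<Sum>i\<in>F. J (m + i) * v i))) \<longlongrightarrow> u m - 0) (finite_subsets_at_top UNIV)"
    by (intro tendsto_intros)
  then show ?thesis
    unfolding has_sum_def by simp
qed

section \<open>The Hankel kernel and the inequality for sequences\<close>

text \<open>The factor \<open>a powi k\<close> distributes the weight \<open>(a^2)^k\<close> of
  \<open>bessel_coeff_orthogonal\<close> over both rows. With \<open>a\<close> as parameter, raising
  the order by one is multiplication by \<open>q\<close>.\<close>

definition bessel_kernel :: "real \<Rightarrow> real \<Rightarrow> int \<Rightarrow> real" where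
  "bessel_kernel q a k = a powi k * bessel_coeff (q\<^sup>2) (a\<^sup>2) k"

context
  fixes q :: real
  assumes q: "0 < q" "q < 1"
begin

lemma square_base: "0 < q\<^sup>2" "q\<^sup>2 < 1"
  using q by (simp_all add: power_less_one_iff)

text \<open>This is \<open>bessel_coeff_orthogonal\<close> at \<open>k = i + n\<close> and
  \<open>l = j - i\<close>. The prefactor \<open>a powi (j - i)\<close> balances the powers and
  equals 1 in the only nonzero case.\<close>

lemma bessel_kernel_orthogonal:
  assumes a: "0 < a" "a < 1"
  shows "((\<lambda>n. bessel_kernel q a (i + n) * bessel_kernel q a (j + n)) has_sum (if i = j then 1 else 0)) UNIV"
proof -
  have b: "0 < a\<^sup>2" "a\<^sup>2 < 1"
    using a by (simp_all add: power_less_one_iff)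
  let ?f = "\<lambda>k. a powi (j - i) *
      ((a\<^sup>2) powi k * (bessel_coeff (q\<^sup>2) (a\<^sup>2) k * bessel_coeff (q\<^sup>2) (a\<^sup>2) (k + (j - i))))"
  have "(?f has_sum a powi (j - i) * (if j - i = 0 then 1 else 0)) UNIV"
    by (intro has_sum_cmult_right bessel_coeff_orthogonal square_base b)
  moreover have "a powi (j - i) * (if j - i = 0 then 1 else 0) = (if i = j then 1 else 0)"
    by simp
  ultimately have "(?f has_sum (if i = j then 1 else 0)) UNIV"
    by (simp only: )
  moreover have "bij_betw (\<lambda>n. i + n) UNIV UNIV"
    by (rule bij_betw_byWitness[where f' = "\<lambda>n. n - i"]) auto
  ultimately have "((\<lambda>n. ?f (i + n)) has_sum (if i = j then 1 else 0)) UNIV"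
    by (subst has_sum_reindex_bij_betw)
  moreover have "?f (i + n) = bessel_kernel q a (i + n) * bessel_kernel q a (j + n)" for n
  proof -
    have "a powi (j - i) * (a\<^sup>2) powi (i + n) = a powi (i + n) * a powi (j + n)"
      using a power_int_add[of a "j - i" "i + n"]
      by (simp add: power2_eq_square power_int_mult_distrib)
    moreover have shift: "i + n + (j - i) = j + n" by simp
    ultimately show ?thesis
      unfolding bessel_kernel_def shift by algebra
  qed
  ultimately show ?thesis by (simp only: )
qed

text \<open>Half of \<open>(q^2)^(k + 1)\<close> is absorbed into \<open>(a * q)^(k + 1)\<close>. At
  a Hankel index \<open>k + 1 = m + i\<close> the remaining power splits into \<open>q^m\<close> and
  \<open>q^i\<close>, so a difference in \<open>m\<close> becomes multiplication by
  \<open>q^i\<close> on the transform side.\<close>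

lemma bessel_kernel_diff:
  assumes a: "0 < a"
  shows "bessel_kernel q a (k + 1) - a * bessel_kernel q a k = q powi (k + 1) * bessel_kernel q (a * q) (k + 1)"
proof -
  have "bessel_kernel q a (k + 1) - a * bessel_kernel q a k
      = a powi (k + 1) * (bessel_coeff (q\<^sup>2) (a\<^sup>2) (k + 1) - bessel_coeff (q\<^sup>2) (a\<^sup>2) k)"
    using a by (simp add: bessel_kernel_def power_int_add algebra_simps)
  also have "\<dots> = a powi (k + 1) * ((q\<^sup>2) powi (k + 1) * bessel_coeff (q\<^sup>2) (a\<^sup>2 * q\<^sup>2) (k + 1))"
    by (simp only: bessel_coeff_diff[OF square_base])
  also have "\<dots> = q powi (k + 1) * bessel_kernel q (a * q) (k + 1)"
    by (simp add: bessel_kernel_def power2_eq_square power_int_mult_distrib mult_ac)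
  finally show ?thesis .
qed

lemma bessel_kernel_uncertainty:
  fixes u v :: "int \<Rightarrow> real"
  assumes a: "0 < a" "a < 1"
    and u: "((\<lambda>n. (u n)\<^sup>2) has_sum R) UNIV"
    and v: "\<And>m. ((\<lambda>n. bessel_kernel q a (m + n) * u n) has_sum v m) UNIV"
    and A: "((\<lambda>n. (q powi n * u n)\<^sup>2) has_sum A) UNIV"
    and B: "((\<lambda>n. (q powi n * v n)\<^sup>2) has_sum B) UNIV"
  shows "(1 - a\<^sup>2) * R \<le> (1 + a * q) * (sqrt A * sqrt B)"
proof -
  have aq: "0 < a * q" "a * q < 1"
    using a q mult_strict_mono[of a 1 q 1] by simp_all
  \<comment> \<open>The power \<open>q powi (- m)\<close> cancels the \<open>q^m\<close> from
    \<open>bessel_kernel_diff\<close>, so that \<open>D\<close> is the transform of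
    \<open>q^i * v i\<close> under the kernel with parameter \<open>a * q\<close>.\<close>
  define D where "D m = q powi (- m) * (u m - a * u (m - 1))" for m
  have bij: "bij_betw (\<lambda>m::int. m - 1) UNIV UNIV"
    by (rule bij_betw_byWitness[where f' = "\<lambda>n. n + 1"]) auto
  have inversion: "((\<lambda>i. bessel_kernel q a (m + i) * v i) has_sum u m) UNIV" for m
    using bessel_kernel_orthogonal[OF a] has_sum_imp_summable[OF u] v by (rule hankel_inversion)
  have D: "((\<lambda>i. bessel_kernel q (a * q) (m + i) * (q powi i * v i)) has_sum D m) UNIV" for m
  proof -
    have "((\<lambda>i. q powi (- m) * (bessel_kernel q a (m + i) * v i + - (a * (bessel_kernel q a (m - 1 + i) * v i))))
        has_sum q powi (- m) * (u m + - (a * u (m - 1)))) UNIV"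
      by (intro has_sum_cmult_right has_sum_add has_sum_uminusI inversion)
    moreover have "q powi (- m) * (bessel_kernel q a (m + i) * v i + - (a * (bessel_kernel q a (m - 1 + i) * v i)))
        = bessel_kernel q (a * q) (m + i) * (q powi i * v i)" for i
    proof -
      have "bessel_kernel q a (m + i) - a * bessel_kernel q a (m - 1 + i)
          = q powi (m + i) * bessel_kernel q (a * q) (m + i)"
        using bessel_kernel_diff[OF a(1), of "m - 1 + i"] by (simp add: algebra_simps)
      moreover have "q powi (m + i) = q powi m * q powi i" "q powi (- m) * q powi m = 1"
        using q by (simp_all add: power_int_add power_int_minus)
      ultimately show ?thesis by algebra
    qed
    ultimately show ?thesis by (simp add: D_def)
  qed
  note D2 = Bessel_inequality[OF bessel_kernel_orthogonal[OF aq] B D]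
  have DB: "sqrt (\<Sum>\<^sub>\<infinity>i. (D i)\<^sup>2) \<le> sqrt B"
    using D2(2) by (rule real_sqrt_le_mono)
  \<comment> \<open>The sequence \<open>q^n * u (n - 1)\<close> is \<open>q\<close> times a
    translate of \<open>q^n * u n\<close>; hence the factor \<open>a * q\<close> in the
    constant.\<close>
  have A': "((\<lambda>n. (q powi (n - 1) * u (n - 1))\<^sup>2) has_sum A) UNIV"
    using A by (subst has_sum_reindex_bij_betw[OF bij])
  have u': "((\<lambda>n. (u (n - 1))\<^sup>2) has_sum R) UNIV"
    using u by (subst has_sum_reindex_bij_betw[OF bij])
  obtain S1 where S1: "((\<lambda>n. D n * (q powi n * u n)) has_sum S1) UNIV"
    using square_summable_mult[OF D2(1) has_sum_imp_summable[OF A]] by (meson has_sum_infsum)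
  obtain S2 where S2: "((\<lambda>n. D n * (q powi (n - 1) * u (n - 1))) has_sum S2) UNIV"
    using square_summable_mult[OF D2(1) has_sum_imp_summable[OF A']] by (meson has_sum_infsum)
  have A0: "0 \<le> sqrt A"
    using has_sum_nonneg[OF A] by simp
  have S1_le: "S1 \<le> sqrt A * sqrt B"
    using has_sum_Cauchy_Schwarz[OF S1 has_sum_infsum[OF D2(1)] A] mult_right_mono[OF DB A0]
    by (simp add: mult.commute)
  have S2_le: "S2 \<le> sqrt A * sqrt B"
    using has_sum_Cauchy_Schwarz[OF S2 has_sum_infsum[OF D2(1)] A'] mult_right_mono[OF DB A0]
    by (simp add: mult.commute)
  have "((\<lambda>n. D n * (q powi n * u n) + (a * q) * (D n * (q powi (n - 1) * u (n - 1))))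
      has_sum S1 + (a * q) * S2) UNIV"
    by (intro has_sum_add has_sum_cmult_right S1 S2)
  moreover have "D n * (q powi n * u n) + (a * q) * (D n * (q powi (n - 1) * u (n - 1)))
      = (u n)\<^sup>2 + - (a\<^sup>2 * (u (n - 1))\<^sup>2)" for n
  proof -
    have "q powi n = q * q powi (n - 1)" "q powi (- n) * q powi n = 1"
      using q power_int_add[of q 1 "n - 1"] power_int_add[of q "- n" n] by simp_all
    then show ?thesis unfolding D_def by algebra
  qed
  ultimately have "((\<lambda>n. (u n)\<^sup>2 + - (a\<^sup>2 * (u (n - 1))\<^sup>2)) has_sum S1 + (a * q) * S2) UNIV"
    by simp
  \<comment> \<open>A shift does not change a sum over all integers, so the differences of squares
    add up to \<open>(1 - a^2) * R\<close>.\<close>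
  moreover have "((\<lambda>n. (u n)\<^sup>2 + - (a\<^sup>2 * (u (n - 1))\<^sup>2)) has_sum R + - (a\<^sup>2 * R)) UNIV"
    by (intro has_sum_add has_sum_uminusI has_sum_cmult_right u u')
  ultimately have "S1 + (a * q) * S2 = R + - (a\<^sup>2 * R)"
    by (rule has_sum_unique)
  moreover have "(a * q) * S2 \<le> (a * q) * (sqrt A * sqrt B)"
    using aq by (intro mult_left_mono S2_le) auto
  ultimately show ?thesis
    using S1_le by (simp add: algebra_simps)
qed

section \<open>The transform and the norms in terms of sequences\<close>

text \<open>The series of \<open>bessel_coeff_expansion\<close> agrees termwise with that of
  \<open>qbessel_j\<close> once \<open>(b; p)_inf\<close> is split after \<open>n\<close> factors.
  The constants supply the quotient of infinite products.\<close>

lemma qbessel_j_eq: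
  assumes \<nu>: "\<nu> > -1"
  shows "qbessel_const q \<nu> * (1 - q) * qbessel_j q \<nu> (q powi k) = bessel_coeff (q\<^sup>2) (q powr (2 * \<nu> + 2)) k"
proof -
  let ?p = "q\<^sup>2" and ?b = "q powr (2 * \<nu> + 2)"
  have b: "0 < ?b" "?b < 1"
    using q \<nu> by (simp_all add: powr01_less_one)
  have nz: "qpoch_inf ?b ?p \<noteq> 0" "qpoch_inf ?p ?p \<noteq> 0"
    using square_base b by (intro qpoch_inf_nonzero[OF square_base] less_imp_le; simp)+
  let ?t = "\<lambda>n. (-1) ^ n * (q ^ (n * (n + 1)) / (qpoch ?b ?p n * qpoch ?p ?p n)) * (q powi k) ^ (2 * n)"
  have "euler_coeff ?p n * (?p powi (k + 1)) ^ n * qpoch_inf (?b * ?p ^ n) ?p = qpoch_inf ?b ?p * ?t n" for n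
  proof -
    have split: "qpoch_inf ?b ?p = qpoch ?b ?p n * qpoch_inf (?b * ?p ^ n) ?p"
      by (rule qpoch_inf_split[OF square_base])
    then have "qpoch ?b ?p n \<noteq> 0" using nz by auto
    moreover have "?p ^ (n choose 2) * (?p powi (k + 1)) ^ n = q ^ (n * (n + 1)) * (q powi k) ^ (2 * n)"
    proof -
      have "2 * (n choose 2) + 2 * n = n * (n + 1)"
        by (induction n) (auto simp: numeral_2_eq_2 binomial_eq_0)
      then have "?p ^ (n choose 2) * ?p ^ n = q ^ (n * (n + 1))"
        by (metis power_add power_mult)
      moreover have "?p powi (k + 1) = ?p * (q powi k)\<^sup>2"
        using q by (simp add: power_int_add power2_eq_square power_int_mult_distrib)
      ultimately show ?thesis
        by (simp add: power_mult_distrib power_mult)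
    qed
    ultimately show ?thesis
      unfolding split euler_coeff_def by (simp add: field_simps)
  qed
  then have "(\<lambda>n. qpoch_inf ?b ?p * ?t n) sums (qpoch_inf ?p ?p * bessel_coeff ?p ?b k)"
    using has_sum_imp_sums[OF bessel_coeff_expansion[OF square_base, of k ?b]] by (simp only: )
  then have "(\<lambda>n. inverse (qpoch_inf ?b ?p) * (qpoch_inf ?b ?p * ?t n))
      sums (inverse (qpoch_inf ?b ?p) * (qpoch_inf ?p ?p * bessel_coeff ?p ?b k))"
    by (rule sums_mult)
  moreover have "inverse (qpoch_inf ?b ?p) * (qpoch_inf ?b ?p * ?t n) = ?t n" for n
    using nz by simp
  ultimately have "qbessel_j q \<nu> (q powi k) = inverse (qpoch_inf ?b ?p) * (qpoch_inf ?p ?p * bessel_coeff ?p ?b k)"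
    unfolding qbessel_j_def by (simp only: sums_iff)
  then show ?thesis
    using nz q by (simp add: qbessel_const_def field_simps)
qed

lemma powi_powr: "(q powi n) powr s = q powr (s * of_int n)"
  using q by (simp add: powr_powr mult.commute flip: powr_real_of_int')

lemma powr_powi: "(q powr s) powi n = q powr (s * of_int n)"
  using q by (simp add: powr_powr flip: powr_real_of_int')

text \<open>At \<open>t = q^n\<close> the Jackson weight and \<open>t^(2\<nu>+1)\<close> combine to
  \<open>a^(2n)\<close>, where \<open>a = q^(\<nu>+1)\<close>. One \<open>a^n\<close> joins
  \<open>a^m\<close> in the kernel, the other goes to the sequence.\<close>

lemma qbessel_fourier_eq:
  assumes \<nu>: "\<nu> > -1"
  shows "(q powr (\<nu> + 1)) powi m * qbessel_fourier q \<nu> f (q powi m)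
    = (\<Sum>\<^sub>\<infinity>n. bessel_kernel q (q powr (\<nu> + 1)) (m + n) * ((q powr (\<nu> + 1)) powi n * f (q powi n)))"
proof -
  let ?a = "q powr (\<nu> + 1)"
  have "?a powi m * qbessel_fourier q \<nu> f (q powi m)
      = (\<Sum>\<^sub>\<infinity>n. ?a powi m * qbessel_const q \<nu> * (1 - q) *
          (q powi n * (f (q powi n) * qbessel_j q \<nu> (q powi m * q powi n) * (q powi n) powr (2 * \<nu> + 1))))"
    by (simp add: qbessel_fourier_def jackson_integral_def infsum_cmult_right' mult.assoc)
  also have "\<dots> = (\<Sum>\<^sub>\<infinity>n. bessel_kernel q ?a (m + n) * (?a powi n * f (q powi n)))"
  proof (rule infsum_cong)
    fix n :: int
    have "?a powi m * (q powi n * (q powi n) powr (2 * \<nu> + 1)) = ?a powi (m + n) * ?a powi n"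
    proof -
      have "q powi n = q powr of_int n"
        using powi_powr[of n 1] q by simp
      then show ?thesis
        unfolding powi_powr powr_powi by (simp add: powr_add[symmetric] algebra_simps)
    qed
    moreover have "?a\<^sup>2 = q powr (2 * \<nu> + 2)"
      using q by (simp add: powr_power algebra_simps)
    moreover have "qbessel_const q \<nu> * (1 - q) * qbessel_j q \<nu> (q powi m * q powi n)
        = bessel_coeff (q\<^sup>2) (q powr (2 * \<nu> + 2)) (m + n)"
      using qbessel_j_eq[OF \<nu>, of "m + n"] q by (simp add: power_int_add)
    ultimately show "?a powi m * qbessel_const q \<nu> * (1 - q) *
        (q powi n * (f (q powi n) * qbessel_j q \<nu> (q powi m * q powi n) * (q powi n) powr (2 * \<nu> + 1)))
      = bessel_kernel q ?a (m + n) * (?a powi n * f (q powi n))"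
      unfolding bessel_kernel_def by algebra
  qed
  finally show ?thesis .
qed

end

text \<open>A finite extended sum bounds all partial sums, which gives real summability; continuity
  of \<open>ennreal\<close> identifies the two values.\<close>

lemma has_sum_of_finite_ennreal:
  fixes h :: "'a \<Rightarrow> real"
  assumes h: "\<And>n. 0 \<le> h n" and fin: "(\<Sum>\<^sub>\<infinity>n. ennreal (h n)) < \<infinity>"
  obtains S where "(h has_sum S) UNIV" "(\<Sum>\<^sub>\<infinity>n. ennreal (h n)) = ennreal S"
proof -
  let ?T = "\<Sum>\<^sub>\<infinity>n. ennreal (h n)"
  have le: "sum h F \<le> enn2real ?T" if "finite F" for F
  proof -
    have "ennreal (sum h F) = (\<Sum>n\<in>F. ennreal (h n))"
      using h by (intro sum_ennreal[symmetric]) auto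
    also have "\<dots> \<le> ?T"
      by (subst infsum_finite[OF that, symmetric], rule infsum_mono_neutral)
        (use that in \<open>auto intro: nonneg_summable_on_complete\<close>)
    finally show ?thesis
      using fin by (metis enn2real_mono enn2real_ennreal h sum_nonneg infinity_ennreal_def)
  qed
  have "h summable_on UNIV"
    by (rule nonneg_bdd_above_summable_on) (auto intro!: h bdd_aboveI2 le)
  then have S: "(h has_sum infsum h UNIV) UNIV"
    by (rule has_sum_infsum)
  have "((\<lambda>F. ennreal (sum h F)) \<longlongrightarrow> ennreal (infsum h UNIV)) (finite_subsets_at_top UNIV)"
    using S unfolding has_sum_def by (rule tendsto_ennrealI)
  moreover have "ennreal (sum h F) = (\<Sum>n\<in>F. ennreal (h n))" for F
    using h by (intro sum_ennreal[symmetric]) auto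
  ultimately have "((\<lambda>n. ennreal (h n)) has_sum ennreal (infsum h UNIV)) UNIV"
    unfolding has_sum_def by simp
  then show ?thesis
    using S that infsumI by blast
qed

text \<open>The same merging of weights makes the norm \<open>sqrt (1 - q)\<close> times the l2 norm
  of \<open>a^n * g (q^n)\<close>.\<close>

lemma q2norm_finite:
  assumes q: "0 < q" "q < 1" and fin: "q2norm q \<nu> g < \<infinity>"
  obtains S where "((\<lambda>n. ((q powr (\<nu> + 1)) powi n * g (q powi n))\<^sup>2) has_sum S) UNIV"
    and "q2norm q \<nu> g = ennreal (sqrt (1 - q) * sqrt S)"
proof -
  let ?h = "\<lambda>n. ((q powr (\<nu> + 1)) powi n * g (q powi n))\<^sup>2"
  have "ennreal (q powi n) * ennreal (\<bar>g (q powi n)\<bar>\<^sup>2 * (q powi n) powr (2 * \<nu> + 1)) = ennreal (?h n)" for n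
  proof -
    have "q powi n = q powr of_int n"
      using powi_powr[OF q, of n 1] q by simp
    then have "q powi n * (q powi n) powr (2 * \<nu> + 1) = ((q powr (\<nu> + 1)) powi n)\<^sup>2"
      unfolding powi_powr[OF q] powr_powi[OF q] power2_eq_square
      by (simp add: powr_add[symmetric] algebra_simps)
    then have "q powi n * (\<bar>g (q powi n)\<bar>\<^sup>2 * (q powi n) powr (2 * \<nu> + 1)) = ?h n"
      by (simp add: power_mult_distrib mult_ac)
    then show ?thesis
      using q by (simp add: ennreal_mult[symmetric])
  qed
  then have J: "jackson_nn_integral q (\<lambda>x. ennreal (\<bar>g x\<bar>\<^sup>2 * x powr (2 * \<nu> + 1)))
      = ennreal (1 - q) * (\<Sum>\<^sub>\<infinity>n. ennreal (?h n))"
    by (simp only: jackson_nn_integral_def)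
  have "ennreal (1 - q) * (\<Sum>\<^sub>\<infinity>n. ennreal (?h n)) \<noteq> \<infinity>"
    using fin unfolding q2norm_def ennreal_sqrt_def J by (auto split: if_splits)
  \<comment> \<open>Since \<open>1 - q\<close> is positive, an infinite sum would make the product
    infinite.\<close>
  then have "(\<Sum>\<^sub>\<infinity>n. ennreal (?h n)) < \<infinity>"
    using q by (auto simp: ennreal_mult_eq_top_iff less_top)
  then obtain S where S: "(?h has_sum S) UNIV" "(\<Sum>\<^sub>\<infinity>n. ennreal (?h n)) = ennreal S"
    using has_sum_of_finite_ennreal[of ?h] by auto
  have "0 \<le> S"
    using has_sum_nonneg[OF S(1)] by simp
  then have "q2norm q \<nu> g = ennreal (sqrt (1 - q) * sqrt S)"
    using q unfolding q2norm_def ennreal_sqrt_def J S(2)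
    by (simp add: ennreal_mult[symmetric] real_sqrt_mult)
  with S(1) show ?thesis by (rule that)
qed

theorem theorem6:
  fixes q \<nu> :: real and f :: "real \<Rightarrow> real"
  assumes "0 < q" and "q < 1" and "\<nu> > -1"
    and "f \<in> L2q q \<nu>"
  shows "q2norm q \<nu> (\<lambda>x. x * f x) = \<infinity>
       \<or> q2norm q \<nu> (\<lambda>x. x * qbessel_fourier q \<nu> f x) = \<infinity>
       \<or> (q2norm q \<nu> f)\<^sup>2
           \<le> ennreal ((1 + sqrt q * q powr (\<nu> + 1)) / (1 - q powr (2 * (\<nu> + 1))))
             * q2norm q \<nu> (\<lambda>x. x * f x)
             * q2norm q \<nu> (\<lambda>x. x * qbessel_fourier q \<nu> f x)"
    (is "?X = \<infinity> \<or> ?Y = \<infinity> \<or> ?N\<^sup>2 \<le> ennreal ?k * ?X * ?Y")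
proof (cases "?X = \<infinity> \<or> ?Y = \<infinity>")
  case False
  note q = assms(1,2)
  define a where "a = q powr (\<nu> + 1)"
  define u where "u n = a powi n * f (q powi n)" for n
  define v where "v n = a powi n * qbessel_fourier q \<nu> f (q powi n)" for n
  have a: "0 < a" "a < 1"
    using assms by (simp_all add: a_def powr01_less_one)
  have fin: "?N < \<infinity>" "?X < \<infinity>" "?Y < \<infinity>"
    using False assms(4) by (auto simp: L2q_def less_top)
  obtain R where R: "((\<lambda>n. (u n)\<^sup>2) has_sum R) UNIV" "?N = ennreal (sqrt (1 - q) * sqrt R)"
    unfolding u_def a_def by (rule q2norm_finite[OF q fin(1)])
  obtain A where A: "((\<lambda>n. (a powi n * (q powi n * f (q powi n)))\<^sup>2) has_sum A) UNIV"
      "?X = ennreal (sqrt (1 - q) * sqrt A)"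
    unfolding a_def by (rule q2norm_finite[OF q fin(2)])
  obtain B where B: "((\<lambda>n. (a powi n * (q powi n * qbessel_fourier q \<nu> f (q powi n)))\<^sup>2) has_sum B) UNIV"
      "?Y = ennreal (sqrt (1 - q) * sqrt B)"
    unfolding a_def by (rule q2norm_finite[OF q fin(3)])
  have nonneg: "0 \<le> R" "0 \<le> A" "0 \<le> B"
    using has_sum_nonneg[OF R(1)] has_sum_nonneg[OF A(1)] has_sum_nonneg[OF B(1)] by simp_all
  have kernel: "((\<lambda>n. (bessel_kernel q a (m + n))\<^sup>2) has_sum 1) UNIV" for m
    using bessel_kernel_orthogonal[OF q a, of m m] by (simp add: power2_eq_square)
  \<comment> \<open>Kernel rows and \<open>u\<close> are square summable, so the series of the
    transform converges and its \<open>infsum\<close> is a genuine sum.\<close>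
  have v: "((\<lambda>n. bessel_kernel q a (m + n) * u n) has_sum v m) UNIV" for m
    using has_sum_infsum[OF square_summable_mult[OF has_sum_imp_summable[OF kernel] has_sum_imp_summable[OF R(1)]]]
    by (simp only: v_def u_def a_def qbessel_fourier_eq[OF q assms(3)])
  have "(1 - a\<^sup>2) * R \<le> (1 + a * q) * (sqrt A * sqrt B)"
    by (rule bessel_kernel_uncertainty[OF q a R(1) v])
      (use A(1) B(1) in \<open>simp_all add: u_def v_def mult_ac\<close>)
  \<comment> \<open>Here \<open>a * q\<close> is weakened to the stated
    \<open>sqrt q * a\<close>.\<close>
  also have "\<dots> \<le> (1 + sqrt q * a) * (sqrt A * sqrt B)"
  proof (intro mult_right_mono add_left_mono)
    have "q \<le> sqrt q"
      using q by (intro real_le_rsqrt) (simp add: power2_eq_square)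
    then show "a * q \<le> sqrt q * a"
      using a by simp
  qed (use nonneg in simp)
  finally have "R \<le> (1 + sqrt q * a) / (1 - a\<^sup>2) * (sqrt A * sqrt B)"
    using a by (simp add: field_simps power_less_one_iff)
  moreover have "a\<^sup>2 = q powr (2 * (\<nu> + 1))"
    using q by (simp add: a_def powr_power algebra_simps)
  moreover define K where "K = ?k"
  ultimately have "R \<le> K * (sqrt A * sqrt B)"
    by (simp add: a_def)
  \<comment> \<open>The factor \<open>1 - q\<close> belongs to the squared norm on the left and is
    shared as two roots by the norms on the right.\<close>
  then have "(1 - q) * R \<le> (1 - q) * (K * (sqrt A * sqrt B))"
    using q by (intro mult_left_mono) auto
  also have "\<dots> = (sqrt (1 - q) * sqrt (1 - q)) * (K * (sqrt A * sqrt B))"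
    using q by simp
  also have "\<dots> = K * (sqrt (1 - q) * sqrt A) * (sqrt (1 - q) * sqrt B)"
    by algebra
  also have "(1 - q) * R = (sqrt (1 - q) * sqrt R)\<^sup>2"
    using q nonneg by (simp add: power_mult_distrib)
  finally have "ennreal ((sqrt (1 - q) * sqrt R)\<^sup>2)
      \<le> ennreal (K * (sqrt (1 - q) * sqrt A) * (sqrt (1 - q) * sqrt B))"
    by (rule ennreal_leI)
  moreover have "0 \<le> K"
    unfolding K_def using q assms(3) by (intro divide_nonneg_nonneg) (auto simp: powr_le1)
  ultimately have "?N\<^sup>2 \<le> ennreal K * ?X * ?Y"
    unfolding R(2) A(2) B(2) using q nonneg
    by (simp only: ennreal_power[symmetric] ennreal_mult mult_nonneg_nonneg real_sqrt_ge_zero diff_ge_0_iff_ge less_imp_le)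
  then show ?thesis
    unfolding K_def by blast
qed blast

end
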